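(* Let $\mathbb{F}$ be an algebraically closed field of characteristic $0$, and let $f_1,\dots,f_r,f\in \mathbb{F}\langle X\rangle$ be free noncommutative polynomials in the variables $x_1,\dots,x_g$. The implication $$\mathrm{tr}(f_1(A))=\dots=\mathrm{tr}(f_r(A))=0 \quad\implies\quad \mathrm{tr}(f(A))=0$$ holds for every $n\in\mathbb{N}$ and all $A\in M_n(\mathbb{F})^g$ if and only if at least one of the following holds: $f$ is cyclically equivalent to an $\mathbb{F}$-linear combination of $f_1,\dots,f_r$, or some $\mathbb{F}$-linear combination of $f_1,\dots,f_r$ is cyclically equivalent to a nonzero scalar.
   Context: $\mathbb{F}\langle X\rangle$ denotes the free associative unital $\mathbb{F}$-algebra on the noncommuting variables $x_1,\dots,x_g$. Two polynomials $f,h\in\mathbb{F}\langle X\rangle$ are cyclically equivalent if $f-h$ is a (finite) sum of commutators $[p,q]=pq-qp$ with $p,q\in\mathbb{F}\langle X\rangle$. For $A=(a_1,\dots,a_g)\in M_n(\mathbb{F})^g$, $f(A)\in M_n(\mathbb{F})$ is the evaluation $x_i\mapsto a_i$ (a constant $c$ evaluates to $cI_n$), and $\mathrm{tr}$ is the usual matrix trace. Here $n\geq 1$. *)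

theory Defs
  imports "HOL-Library.Poly_Mapping" "HOL-Computational_Algebra.Polynomial" "Jordan_Normal_Form.Matrix"
begin

text \<open>
  The free algebra on the variables \<open>'x\<close> over \<open>'f\<close> is the monoid algebra of the free monoid of words
  over \<open>'x\<close>.  The convolution product of \<^theory>\<open>HOL-Library.Poly_Mapping\<close> needs the monoid written
  additively, so words are wrapped lists with concatenation as (noncommutative) addition.
\<close>

datatype 'x nc_word = Word (letters: "'x list")

instantiation nc_word :: (type) monoid_add
begin

definition zero_nc_word :: "'a nc_word" where
  "0 = Word []"

definition plus_nc_word :: "'a nc_word \<Rightarrow> 'a nc_word \<Rightarrow> 'a nc_word" where
  "u + v = Word (letters u @ letters v)"

instance
  by standard (simp_all add: zero_nc_word_def plus_nc_word_def)

end

type_synonym ('x, 'f) nc_poly = "'x nc_word \<Rightarrow>\<^sub>0 'f"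

definition nc_const :: "'f::zero \<Rightarrow> ('x, 'f) nc_poly" where
  "nc_const c = Poly_Mapping.single 0 c"

definition nc_var :: "'x \<Rightarrow> ('x, 'f::zero_neq_one) nc_poly" where
  "nc_var x = Poly_Mapping.single (Word [x]) 1"

definition nc_lincomb :: "nat \<Rightarrow> (nat \<Rightarrow> 'f::ring_1) \<Rightarrow> (nat \<Rightarrow> ('x, 'f) nc_poly) \<Rightarrow> ('x, 'f) nc_poly" where
  "nc_lincomb r c fs = (\<Sum>i=1..r. nc_const (c i) * fs i)"

definition cyc_equiv :: "('x, 'f::ring_1) nc_poly \<Rightarrow> ('x, 'f) nc_poly \<Rightarrow> bool" where
  "cyc_equiv f h \<longleftrightarrow>
     (\<exists>pqs :: (('x, 'f) nc_poly \<times> ('x, 'f) nc_poly) list. f - h = (\<Sum>(p, q)\<leftarrow>pqs. p * q - q * p))"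

definition word_eval :: "nat \<Rightarrow> ('x \<Rightarrow> 'f::semiring_1 mat) \<Rightarrow> 'x nc_word \<Rightarrow> 'f mat" where
  "word_eval n A w = foldr (\<lambda>x M. A x * M) (letters w) (1\<^sub>m n)"

text \<open>
  The matrices are not a \<^class>\<open>comm_monoid_add\<close>, because their dimension is not part of the type;
  hence the linear combination of the evaluated words is formed entrywise.
\<close>

definition nc_eval :: "nat \<Rightarrow> ('x \<Rightarrow> 'f::semiring_1 mat) \<Rightarrow> ('x, 'f) nc_poly \<Rightarrow> 'f mat" where
  "nc_eval n A f =
     mat n n (\<lambda>ij. \<Sum>w\<in>Poly_Mapping.keys f. Poly_Mapping.lookup f w * word_eval n A w $$ ij)"

definition mat_trace :: "'f::comm_monoid_add mat \<Rightarrow> 'f" where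
  "mat_trace M = (\<Sum>i<dim_row M. M $$ (i, i))"

text \<open>
  \<^const>\<open>nc_eval\<close> is the unital algebra homomorphism that maps the variable \<open>x\<close> to the matrix \<open>A x\<close>.
\<close>

lemma nc_eval_carrier [simp]: "nc_eval n A f \<in> carrier_mat n n"
  by (simp add: nc_eval_def)

lemma word_eval_carrier [simp]:
  assumes "\<And>x. A x \<in> carrier_mat n n"
  shows "word_eval n A w \<in> carrier_mat n n"
proof -
  have "foldr (\<lambda>x M. A x * M) xs (1\<^sub>m n) \<in> carrier_mat n n" for xs
    by (induction xs) (auto intro: mult_carrier_mat[OF assms])
  then show ?thesis by (simp add: word_eval_def)
qed

lemma word_eval_plus:
  fixes A :: "'x \<Rightarrow> 'f::semiring_1 mat"
  assumes "\<And>x. A x \<in> carrier_mat n n"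
  shows "word_eval n A (u + v) = word_eval n A u * word_eval n A v"
proof -
  have c: "foldr (\<lambda>x M. A x * M) xs (1\<^sub>m n) \<in> carrier_mat n n" for xs
    by (induction xs) (auto intro: mult_carrier_mat[OF assms])
  have "foldr (\<lambda>x M. A x * M) (xs @ ys) (1\<^sub>m n) =
          foldr (\<lambda>x M. A x * M) xs (1\<^sub>m n) * foldr (\<lambda>x M. A x * M) ys (1\<^sub>m n)" for xs ys
  proof (induction xs)
    case Nil
    then show ?case using c[of ys] by simp
  next
    case (Cons x xs)
    then show ?case using assoc_mult_mat[OF assms[of x] c[of xs] c[of ys]] by simp
  qed
  then show ?thesis by (simp add: word_eval_def plus_nc_word_def)
qed

lemma nc_eval_superset:
  assumes "finite S" "Poly_Mapping.keys f \<subseteq> S"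
  shows "nc_eval n A f = mat n n (\<lambda>ij. \<Sum>w\<in>S. Poly_Mapping.lookup f w * word_eval n A w $$ ij)"
proof -
  have "(\<Sum>w\<in>Poly_Mapping.keys f. Poly_Mapping.lookup f w * word_eval n A w $$ ij) =
        (\<Sum>w\<in>S. Poly_Mapping.lookup f w * word_eval n A w $$ ij)" for ij
    by (rule sum.mono_neutral_left) (use assms in \<open>auto simp: in_keys_iff\<close>)
  then show ?thesis by (simp add: nc_eval_def)
qed

lemma nc_eval_single: "nc_eval n A (Poly_Mapping.single w c) = mat n n (\<lambda>ij. c * word_eval n A w $$ ij)"
  by (simp add: nc_eval_superset[of "{w}"])

lemma nc_eval_const: "nc_eval n A (nc_const c) = c \<cdot>\<^sub>m 1\<^sub>m n"
  by (rule eq_matI) (auto simp: nc_const_def nc_eval_single word_eval_def zero_nc_word_def)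

lemma nc_eval_var:
  assumes "\<And>x. A x \<in> carrier_mat n n"
  shows "nc_eval n A (nc_var x) = A x"
  by (rule eq_matI)
    (use assms[of x] in \<open>auto simp: nc_var_def nc_eval_single word_eval_def\<close>)

lemma nc_eval_zero: "nc_eval n A 0 = 0\<^sub>m n n"
  by (rule eq_matI) (simp_all add: nc_eval_def)

lemma nc_eval_add: "nc_eval n A (f + g) = nc_eval n A f + nc_eval n A g"
proof -
  let ?S = "Poly_Mapping.keys f \<union> Poly_Mapping.keys g"
  have "Poly_Mapping.keys (f + g) \<subseteq> ?S"
    by (rule Poly_Mapping.keys_add)
  then show ?thesis
    by (intro eq_matI)
      (simp_all add: nc_eval_superset[of ?S] lookup_add distrib_right sum.distrib)
qed

lemma nc_poly_induct [case_names zero add_single]: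
  fixes f :: "('x, 'f::comm_monoid_add) nc_poly"
  assumes zero: "P 0" and add: "\<And>w c f. P f \<Longrightarrow> P (Poly_Mapping.single w c + f)"
  shows "P f"
proof -
  have "P (\<Sum>w\<in>S. Poly_Mapping.single w (Poly_Mapping.lookup f w))" if "finite S" for S
    using that by (induction S rule: finite_induct) (simp_all add: assms)
  then have "P (\<Sum>w\<in>Poly_Mapping.keys f. Poly_Mapping.single w (Poly_Mapping.lookup f w))"
    by simp
  also have "(\<Sum>w\<in>Poly_Mapping.keys f. Poly_Mapping.single w (Poly_Mapping.lookup f w)) = f"
    by (rule poly_mapping_eqI)
      (auto simp: lookup_sum lookup_single when_def in_keys_iff)
  finally show ?thesis .
qed

lemma nc_eval_mult:
  fixes A :: "'x \<Rightarrow> 'f::comm_ring_1 mat"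
  assumes A: "\<And>x. A x \<in> carrier_mat n n"
  shows "nc_eval n A (f * g) = nc_eval n A f * nc_eval n A g"
proof -
  have single: "nc_eval n A (Poly_Mapping.single w c) = c \<cdot>\<^sub>m word_eval n A w" for w and c :: 'f
    by (rule eq_matI) (use word_eval_carrier[where A = A and w = w, OF A] in \<open>auto simp: nc_eval_single\<close>)
  have ss: "nc_eval n A (Poly_Mapping.single u c * Poly_Mapping.single v d) =
      nc_eval n A (Poly_Mapping.single u c) * nc_eval n A (Poly_Mapping.single v d)" for u v and c d :: 'f
  proof -
    note uv = word_eval_carrier[where A = A and w = u, OF A] word_eval_carrier[where A = A and w = v, OF A]
    have "(c \<cdot>\<^sub>m word_eval n A u) * (d \<cdot>\<^sub>m word_eval n A v) =
            (c * d) \<cdot>\<^sub>m (word_eval n A u * word_eval n A v)"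
      by (rule eq_matI) (use uv in \<open>auto simp: scalar_prod_def sum_distrib_left ac_simps\<close>)
    then show ?thesis
      by (simp add: mult_single single word_eval_plus[OF A])
  qed
  have sg: "nc_eval n A (Poly_Mapping.single u c * g) =
      nc_eval n A (Poly_Mapping.single u c) * nc_eval n A g" for u and c :: 'f
  proof (induction g rule: nc_poly_induct)
    case zero
    then show ?case by (simp add: nc_eval_zero right_mult_zero_mat[OF nc_eval_carrier])
  next
    case (add_single v d g)
    then show ?case
      by (simp add: distrib_left nc_eval_add ss
          mult_add_distrib_mat[OF nc_eval_carrier nc_eval_carrier nc_eval_carrier])
  qed
  show ?thesis
  proof (induction f rule: nc_poly_induct)
    case zero
    then show ?case by (simp add: nc_eval_zero left_mult_zero_mat[OF nc_eval_carrier])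
  next
    case (add_single v d f)
    then show ?case
      by (simp add: distrib_right nc_eval_add sg
          add_mult_distrib_mat[OF nc_eval_carrier nc_eval_carrier nc_eval_carrier])
  qed
qed

end

theory Submission
  imports Defs
begin

text \<open>
  If neither \<open>f\<close> nor \<open>1\<close> is cyclically equivalent to a linear combination of the \<open>f\<^sub>i\<close>, some linear
  functional \<open>\<phi>\<close> vanishes on all commutators and all \<open>f\<^sub>i\<close> but neither at \<open>f\<close> nor at \<open>1\<close>.  Such a functional
  is a function of words that is invariant under cyclic rotation.  For every \<open>d\<close> there is a size \<open>N\<close> such
  that every rotation-invariant function on the nonempty words of length at most \<open>d\<close> consists of the
  traces of the words at some tuple of \<open>N \<times> N\<close> matrices; scaling \<open>\<phi>\<close> to \<open>\<phi> 1 = N\<close> takes care of the empty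
  word, and the resulting tuple violates the implication.

  The traces are realized by direct sums of weighted directed cycles labelled by words.
\<close>

section \<open>Separating functionals\<close>

text \<open>A basis of \<open>S\<close> stays independent when \<open>v\<close> is added, since
  \<open>v\<close> lies outside its span. The functional is prescribed on the enlarged set and
  extended linearly.\<close>

lemma separating_functional:
  fixes scale :: "'a::field \<Rightarrow> 'b::ab_group_add \<Rightarrow> 'b"
  assumes "vector_space scale" and S: "module.subspace scale S" and v: "v \<notin> S"
  shows "\<exists>\<phi>. Vector_Spaces.linear scale (*) \<phi> \<and> (\<forall>s\<in>S. \<phi> s = 0) \<and> \<phi> v = 1"
proof -
  interpret vector_space_pair scale "(*) :: 'a \<Rightarrow> 'a \<Rightarrow> 'a"
    by (intro vector_space_pair.intro assms(1)) (unfold_locales, simp_all add: algebra_simps)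
  obtain B where B: "B \<subseteq> S" "vs1.independent B" "S \<subseteq> vs1.span B"
    by (rule vs1.maximal_independent_subset)
  have span: "vs1.span B = S"
    by (rule vs1.span_subspace[OF B(1) B(3) S])
  then have "vs1.independent (insert v B)"
    using B v by (auto simp: vs1.independent_insert)
  from linear_independent_extend[OF this, of "\<lambda>b. if b = v then 1 else 0"]
  obtain \<phi> where \<phi>: "Vector_Spaces.linear scale (*) \<phi>"
    "\<forall>x\<in>insert v B. \<phi> x = (if x = v then 1 else 0)"
    by blast
  have "\<phi> b = 0" if "b \<in> B" for b
    using \<phi>(2) that B(1) v by auto
  then have "\<phi> s = 0" if "s \<in> S" for s
    using linear_eq_0_on_span[OF \<phi>(1), of B s] that span by auto
  with \<phi> show ?thesis by auto
qed

text \<open>If neither of the two separating functionals is nonzero at both vectors, the one for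
  \<open>u\<close> vanishes at \<open>v\<close> and the one for \<open>v\<close> vanishes at
  \<open>u\<close>, so their sum is 1 at both.\<close>

lemma separating_functional2:
  fixes scale :: "'a::field \<Rightarrow> 'b::ab_group_add \<Rightarrow> 'b"
  assumes vs: "vector_space scale" and S: "module.subspace scale S" and u: "u \<notin> S" and v: "v \<notin> S"
  shows "\<exists>\<phi>. Vector_Spaces.linear scale (*) \<phi> \<and> (\<forall>s\<in>S. \<phi> s = 0) \<and> \<phi> u \<noteq> 0 \<and> \<phi> v \<noteq> 0"
proof -
  interpret vector_space_pair scale "(*) :: 'a \<Rightarrow> 'a \<Rightarrow> 'a"
    by (intro vector_space_pair.intro vs) (unfold_locales, simp_all add: algebra_simps)
  obtain \<phi> where \<phi>: "Vector_Spaces.linear scale (*) \<phi>" "\<forall>s\<in>S. \<phi> s = 0" "\<phi> u = 1"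
    using separating_functional[OF vs S u] by blast
  obtain \<psi> where \<psi>: "Vector_Spaces.linear scale (*) \<psi>" "\<forall>s\<in>S. \<psi> s = 0" "\<psi> v = 1"
    using separating_functional[OF vs S v] by blast
  have "Vector_Spaces.linear scale (*) (\<lambda>x. \<phi> x + \<psi> x)"
    using linear_compose_add[OF \<phi>(1) \<psi>(1)] .
  then show ?thesis
    using \<phi> \<psi> by (cases "\<phi> v = 0"; cases "\<psi> u = 0")
      (force intro: exI[of _ \<phi>] exI[of _ \<psi>] exI[of _ "\<lambda>x. \<phi> x + \<psi> x"])+
qed

section \<open>Cyclic equivalence\<close>

lemma nc_const_commute: "nc_const c * p = p * nc_const (c :: 'f::comm_ring_1)"
proof (induction p rule: nc_poly_induct)
  case (add_single w d p)
  then show ?case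
    by (simp add: distrib_left distrib_right nc_const_def mult_single mult.commute)
qed simp

lemma nc_const_mult: "nc_const (c * d) = nc_const c * nc_const (d :: 'f::semiring_0)"
  by (simp add: nc_const_def mult_single)

lemma nc_const_add: "nc_const (c + d) = nc_const c + nc_const (d :: 'f::comm_monoid_add)"
  by (simp add: nc_const_def single_add)

lemma nc_const_1: "nc_const (1 :: 'f::semiring_1) = 1"
  by (simp add: nc_const_def)

lemma vector_space_nc_poly: "vector_space (\<lambda>(c::'f::field) f :: ('x, 'f) nc_poly. nc_const c * f)"
  by unfold_locales
    (simp_all add: distrib_left distrib_right nc_const_mult nc_const_add nc_const_1 mult.assoc)

lemma nc_const_neg: "nc_const (- c) = - nc_const (c :: 'f::ab_group_add)"
  by (simp add: nc_const_def single_uminus)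

lemma cyc_equiv_add:
  assumes "cyc_equiv f g" "cyc_equiv f' g'"
  shows "cyc_equiv (f + f') (g + g')"
proof -
  obtain l l' where "f - g = (\<Sum>(p, q)\<leftarrow>l. p * q - q * p)" "f' - g' = (\<Sum>(p, q)\<leftarrow>l'. p * q - q * p)"
    using assms by (auto simp: cyc_equiv_def)
  then have "f + f' - (g + g') = (\<Sum>(p, q)\<leftarrow>l @ l'. p * q - q * p)"
    by (simp add: algebra_simps)
  then show ?thesis unfolding cyc_equiv_def by blast
qed

lemma cyc_equiv_scale:
  fixes f g :: "('x, 'f::comm_ring_1) nc_poly"
  assumes "cyc_equiv f g"
  shows "cyc_equiv (nc_const c * f) (nc_const c * g)"
proof -
  obtain l where l: "f - g = (\<Sum>(p, q)\<leftarrow>l. p * q - q * p)"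
    using assms by (auto simp: cyc_equiv_def)
  \<comment> \<open>Scalars are central, so a scalar can be absorbed into the first factor of each
    commutator.\<close>
  have "nc_const c * (\<Sum>(p, q)\<leftarrow>l. p * q - q * p) =
      (\<Sum>(p, q)\<leftarrow>map (\<lambda>(p, q). (nc_const c * p, q)) l. p * q - q * p)"
  proof (induction l)
    case (Cons pq l)
    obtain p q where pq: "pq = (p, q)" by (cases pq)
    have "nc_const c * (q * p) = q * (nc_const c * p)"
      by (metis nc_const_commute mult.assoc)
    with Cons pq show ?case
      by (simp add: distrib_left right_diff_distrib mult.assoc)
  qed simp
  then show ?thesis
    unfolding cyc_equiv_def l[symmetric] right_diff_distrib by blast
qed

lemma cyc_equiv_refl: "cyc_equiv f f"
  unfolding cyc_equiv_def by (rule exI[of _ "[]"]) simp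

lemma cyc_equiv_sym:
  fixes f g :: "('x, 'f::comm_ring_1) nc_poly"
  assumes "cyc_equiv f g"
  shows "cyc_equiv g f"
proof -
  \<comment> \<open>Adding \<open>f + g\<close> to both negatives leaves \<open>g\<close> on the
    left and \<open>f\<close> on the right.\<close>
  have "cyc_equiv (nc_const (- 1) * f + (f + g)) (nc_const (- 1) * g + (f + g))"
    by (intro cyc_equiv_add cyc_equiv_scale assms cyc_equiv_refl)
  then show ?thesis by (simp add: nc_const_neg nc_const_1)
qed

lemma cyc_equiv_commutator: "cyc_equiv (p * q - q * p) 0"
  unfolding cyc_equiv_def by (rule exI[of _ "[(p, q)]"]) simp

lemma nc_lincomb_add: "nc_lincomb r (\<lambda>i. c i + d i) fs = nc_lincomb r c fs + nc_lincomb r d fs"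
  by (simp add: nc_lincomb_def nc_const_add distrib_right sum.distrib)

lemma nc_lincomb_scale: "nc_lincomb r (\<lambda>i. a * c i) fs = nc_const a * nc_lincomb r c fs"
  by (simp add: nc_lincomb_def nc_const_mult sum_distrib_left mult.assoc)

lemma nc_lincomb_0: "nc_lincomb r (\<lambda>i. 0) fs = 0"
  by (simp add: nc_lincomb_def nc_const_def)

lemma nc_lincomb_unit:
  assumes "i \<in> {1..r}"
  shows "nc_lincomb r (\<lambda>j. if j = i then 1 else 0) fs = fs i"
proof -
  have "nc_lincomb r (\<lambda>j. if j = i then 1 else 0) fs = (\<Sum>j=1..r. if j = i then fs j else 0)"
    unfolding nc_lincomb_def by (rule sum.cong) (auto simp: nc_const_1 nc_const_def)
  then show ?thesis using assms by simp
qed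

text \<open>This set is the span of the commutators and the \<open>fs i\<close>. The first
  alternative of the theorem says that it contains \<open>f\<close>; the second amounts to its
  containing \<open>1\<close>.\<close>

lemma subspace_cyc_lincomb:
  fixes fs :: "nat \<Rightarrow> ('x, 'f::field) nc_poly"
  shows "module.subspace (\<lambda>c f. nc_const c * f) {h. \<exists>c. cyc_equiv h (nc_lincomb r c fs)}"
proof -
  interpret vector_space "\<lambda>(c::'f) f :: ('x, 'f) nc_poly. nc_const c * f"
    by (rule vector_space_nc_poly)
  show ?thesis
  proof (rule subspaceI)
    show "0 \<in> {h. \<exists>c. cyc_equiv h (nc_lincomb r c fs)}"
      using cyc_equiv_refl[of 0] by (auto intro!: exI[of _ "\<lambda>i. 0"] simp: nc_lincomb_0)
  next
    fix x y assume "x \<in> {h. \<exists>c. cyc_equiv h (nc_lincomb r c fs)}" "y \<in> {h. \<exists>c. cyc_equiv h (nc_lincomb r c fs)}"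
    then obtain c d where "cyc_equiv x (nc_lincomb r c fs)" "cyc_equiv y (nc_lincomb r d fs)" by blast
    then have "cyc_equiv (x + y) (nc_lincomb r (\<lambda>i. c i + d i) fs)"
      by (simp add: nc_lincomb_add cyc_equiv_add)
    then show "x + y \<in> {h. \<exists>c. cyc_equiv h (nc_lincomb r c fs)}" by blast
  next
    fix a x assume "x \<in> {h. \<exists>c. cyc_equiv h (nc_lincomb r c fs)}"
    then obtain c where "cyc_equiv x (nc_lincomb r c fs)" by blast
    then have "cyc_equiv (nc_const a * x) (nc_lincomb r (\<lambda>i. a * c i) fs)"
      by (simp add: nc_lincomb_scale cyc_equiv_scale)
    then show "nc_const a * x \<in> {h. \<exists>c. cyc_equiv h (nc_lincomb r c fs)}" by blast
  qed
qed

section \<open>Traces of evaluations\<close>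

lemma mat_trace_comm:
  fixes A B :: "'f::comm_semiring_0 mat"
  assumes "A \<in> carrier_mat n m" "B \<in> carrier_mat m n"
  shows "mat_trace (A * B) = mat_trace (B * A)"
proof -
  have "mat_trace (A * B) = (\<Sum>i<n. \<Sum>j<m. A $$ (i, j) * B $$ (j, i))"
    using assms by (auto simp: mat_trace_def scalar_prod_def atLeast0LessThan intro!: sum.cong)
  also have "\<dots> = (\<Sum>j<m. \<Sum>i<n. B $$ (j, i) * A $$ (i, j))"
    by (subst sum.swap) (simp add: mult.commute)
  also have "\<dots> = mat_trace (B * A)"
    using assms by (auto simp: mat_trace_def scalar_prod_def atLeast0LessThan intro!: sum.cong)
  finally show ?thesis .
qed

lemma mat_trace_nc_eval:
  fixes A :: "'x \<Rightarrow> 'f::comm_semiring_1 mat"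
  assumes A: "\<And>x. A x \<in> carrier_mat n n"
  shows "mat_trace (nc_eval n A f) =
    (\<Sum>w\<in>Poly_Mapping.keys f. Poly_Mapping.lookup f w * mat_trace (word_eval n A w))"
proof -
  have "dim_row (word_eval n A w) = n" for w
    using word_eval_carrier[of A n w] A by blast
  then show ?thesis
    by (simp add: mat_trace_def nc_eval_def sum_distrib_left sum.swap[of _ "{..<n}"])
qed

lemma mat_trace_nc_eval_add:
  "mat_trace (nc_eval n A (f + g)) = mat_trace (nc_eval n A f) + mat_trace (nc_eval n A g)"
  by (simp add: nc_eval_add mat_trace_def sum.distrib carrier_matD[OF nc_eval_carrier])

lemma mat_trace_nc_eval_scale:
  fixes f :: "('x, 'f::comm_ring_1) nc_poly"
  assumes A: "\<And>x. A x \<in> carrier_mat n n"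
  shows "mat_trace (nc_eval n A (nc_const c * f)) = c * mat_trace (nc_eval n A f)"
proof -
  have "nc_eval n A (nc_const c * f) = c \<cdot>\<^sub>m nc_eval n A f"
    by (simp add: nc_eval_mult[OF A] nc_eval_const mult_smult_assoc_mat[of _ n n _ n]
        left_mult_one_mat[OF nc_eval_carrier])
  then show ?thesis by (simp add: mat_trace_def sum_distrib_left carrier_matD[OF nc_eval_carrier])
qed

lemma mat_trace_nc_eval_lincomb:
  fixes fs :: "nat \<Rightarrow> ('x, 'f::comm_ring_1) nc_poly"
  assumes A: "\<And>x. A x \<in> carrier_mat n n"
  shows "mat_trace (nc_eval n A (nc_lincomb r c fs)) = (\<Sum>i=1..r. c i * mat_trace (nc_eval n A (fs i)))"
proof -
  have "mat_trace (nc_eval n A (\<Sum>i\<in>I. nc_const (c i) * fs i)) = (\<Sum>i\<in>I. c i * mat_trace (nc_eval n A (fs i)))"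
    if "finite I" for I
    using that
    by induction (simp_all add: mat_trace_nc_eval_add mat_trace_nc_eval_scale[OF A],
        simp add: nc_eval_zero mat_trace_def)
  then show ?thesis by (simp add: nc_lincomb_def)
qed

text \<open>Commutators have trace zero at every tuple, and the trace of the evaluation is
  additive.\<close>

lemma mat_trace_nc_eval_cong:
  fixes f g :: "('x, 'f::comm_ring_1) nc_poly"
  assumes A: "\<And>x. A x \<in> carrier_mat n n" and "cyc_equiv f g"
  shows "mat_trace (nc_eval n A f) = mat_trace (nc_eval n A g)"
proof -
  have diff: "mat_trace (nc_eval n A (p - q)) = mat_trace (nc_eval n A p) - mat_trace (nc_eval n A q)"
    for p q :: "('x, 'f) nc_poly"
    using mat_trace_nc_eval_add[of n A "p - q" q] by simp
  obtain l where l: "f - g = (\<Sum>(p, q)\<leftarrow>l. p * q - q * p)"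
    using assms by (auto simp: cyc_equiv_def)
  have "mat_trace (nc_eval n A (\<Sum>(p, q)\<leftarrow>l. p * q - q * p)) = 0"
  proof (induction l)
    case Nil
    then show ?case by (simp add: nc_eval_zero mat_trace_def)
  next
    case (Cons pq l)
    then show ?case
      using mat_trace_comm[OF nc_eval_carrier nc_eval_carrier]
      by (auto simp: mat_trace_nc_eval_add diff nc_eval_mult[OF A] split: prod.split)
  qed
  then show ?thesis using l diff[of f g] by simp
qed

section \<open>Realizing prescribed traces\<close>

text \<open>Recording the whole trace function, instead of finitely many prescribed values, turns
  direct sums of tuples into pointwise addition.\<close>

definition realizable :: "nat \<Rightarrow> ('x nc_word \<Rightarrow> 'f::comm_ring_1) \<Rightarrow> bool" where
  "realizable n \<tau> \<longleftrightarrow>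
     (\<exists>A. (\<forall>x. A x \<in> carrier_mat n n) \<and> (\<forall>w. mat_trace (word_eval n A w) = \<tau> w))"

text \<open>Serves the induction on word length: the difference between a target and the traces
  already achieved has to be rotation-invariant again.\<close>

lemma realizable_cyclic:
  assumes "realizable n \<tau>"
  shows "\<tau> (u + v) = \<tau> (v + u)"
proof -
  obtain A where A: "\<And>x. A x \<in> carrier_mat n n" "\<And>w. mat_trace (word_eval n A w) = \<tau> w"
    using assms by (auto simp: realizable_def)
  note c = word_eval_carrier[of A, OF A(1)]
  show ?thesis
    unfolding A(2)[symmetric] word_eval_plus[OF A(1)] by (rule mat_trace_comm[OF c c])
qed

lemma realizable_empty_word:
  assumes "realizable n \<tau>"
  shows "\<tau> 0 = of_nat n"
proof -
  obtain A where "\<And>w. mat_trace (word_eval n A w) = \<tau> w"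
    using assms by (auto simp: realizable_def)
  from this[of 0] show ?thesis by (simp add: word_eval_def mat_trace_def zero_nc_word_def)
qed

text \<open>The neutral element for direct sums; it starts the induction over a set of
  cycles.\<close>

lemma realizable_null: "realizable 0 (\<lambda>w :: 'x nc_word. 0 :: 'f::comm_ring_1)"
proof -
  have "dim_row (word_eval 0 (\<lambda>x::'x. 0\<^sub>m 0 0 :: 'f mat) w) = 0" for w
    by (rule carrier_matD(1)[OF word_eval_carrier]) simp
  then show ?thesis
    unfolding realizable_def by (intro exI[of _ "\<lambda>x. 0\<^sub>m 0 0"]) (simp add: mat_trace_def)
qed

lemma realizable_zero_matrices:
  "realizable n (\<lambda>w :: 'x nc_word. if w = 0 then of_nat n else 0 :: 'f::comm_ring_1)"
proof -
  have "mat_trace (word_eval n (\<lambda>x::'x. 0\<^sub>m n n :: 'f mat) w) = (if w = 0 then of_nat n else 0)" for w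
  proof (cases "letters w")
    case Nil
    then have "w = 0" by (cases w) (simp add: zero_nc_word_def)
    with Nil show ?thesis by (simp add: word_eval_def mat_trace_def)
  next
    case (Cons x v)
    then have "w \<noteq> 0" by (auto simp: zero_nc_word_def)
    moreover have "word_eval n (\<lambda>x::'x. 0\<^sub>m n n :: 'f mat) w = 0\<^sub>m n n * word_eval n (\<lambda>x. 0\<^sub>m n n) (Word v)"
      by (simp add: word_eval_def Cons)
    moreover have "0\<^sub>m n n * word_eval n (\<lambda>x::'x. 0\<^sub>m n n :: 'f mat) (Word v) = 0\<^sub>m n n"
      by (rule left_mult_zero_mat[OF word_eval_carrier]) simp
    ultimately have "word_eval n (\<lambda>x::'x. 0\<^sub>m n n :: 'f mat) w = 0\<^sub>m n n"
      by (simp only:)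
    then show ?thesis
      using \<open>w \<noteq> 0\<close> by (simp add: mat_trace_def)
  qed
  then show ?thesis
    unfolding realizable_def by (intro exI[of _ "\<lambda>x. 0\<^sub>m n n"]) simp
qed

text \<open>Block-diagonal matrices multiply blockwise, so the traces of every word, including the
  empty one, add up.\<close>

lemma realizable_add:
  fixes \<sigma> \<tau> :: "'x nc_word \<Rightarrow> 'f::comm_ring_1"
  assumes "realizable n \<sigma>" "realizable m \<tau>"
  shows "realizable (n + m) (\<lambda>w. \<sigma> w + \<tau> w)"
proof -
  obtain A where A: "\<And>x. A x \<in> carrier_mat n n" "\<And>w. mat_trace (word_eval n A w) = \<sigma> w"
    using assms(1) by (auto simp: realizable_def)
  obtain B where B: "\<And>x. B x \<in> carrier_mat m m" "\<And>w. mat_trace (word_eval m B w) = \<tau> w"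
    using assms(2) by (auto simp: realizable_def)
  define C where "C x = four_block_mat (A x) (0\<^sub>m n m) (0\<^sub>m m n) (B x)" for x
  have C: "C x \<in> carrier_mat (n + m) (n + m)" for x
    unfolding C_def using A(1)[of x] B(1)[of x] by simp
  have block: "word_eval (n + m) C w = four_block_mat (word_eval n A w) (0\<^sub>m n m) (0\<^sub>m m n) (word_eval m B w)" for w
  proof -
    have "word_eval (n + m) C (Word v) =
        four_block_mat (word_eval n A (Word v)) (0\<^sub>m n m) (0\<^sub>m m n) (word_eval m B (Word v))" for v
    proof (induction v)
      case Nil
      show ?case by (rule eq_matI) (auto simp: word_eval_def)
    next
      case (Cons x v)
      note wA = word_eval_carrier[of A n "Word v", OF A(1)] and wB = word_eval_carrier[of B m "Word v", OF B(1)]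
      have "word_eval (n + m) C (Word (x # v)) = C x * word_eval (n + m) C (Word v)"
        by (simp add: word_eval_def)
      also have "\<dots> = four_block_mat (A x * word_eval n A (Word v)) (0\<^sub>m n m) (0\<^sub>m m n) (B x * word_eval m B (Word v))"
        unfolding Cons C_def
        by (subst mult_four_block_mat[OF A(1) _ _ B(1) wA _ _ wB])
          (use wA wB A(1)[of x] B(1)[of x] in \<open>auto intro!: cong_four_block_mat\<close>)
      finally show ?case by (simp add: word_eval_def)
    qed
    then show ?thesis by (metis nc_word.collapse)
  qed
  have sum_split: "(\<Sum>i<n + k. if i < n then g i else h (i - n)) = (\<Sum>i<n. g i) + (\<Sum>i<k. h i)"
    for k and g h :: "nat \<Rightarrow> 'f"
    by (induction k) (simp_all add: add.assoc)
  have "mat_trace (word_eval (n + m) C w) = \<sigma> w + \<tau> w" for w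
  proof -
    note wA = word_eval_carrier[of A n w, OF A(1)] and wB = word_eval_carrier[of B m w, OF B(1)]
    have "mat_trace (word_eval (n + m) C w) =
        (\<Sum>i<n + m. if i < n then word_eval n A w $$ (i, i) else word_eval m B w $$ (i - n, i - n))"
      unfolding block mat_trace_def using wA wB by (intro sum.cong) auto
    also have "\<dots> = (\<Sum>i<n. word_eval n A w $$ (i, i)) + (\<Sum>i<m. word_eval m B w $$ (i, i))"
      by (rule sum_split)
    also have "\<dots> = \<sigma> w + \<tau> w"
      using wA wB by (simp add: mat_trace_def flip: A(2) B(2))
    finally show ?thesis .
  qed
  with C show ?thesis unfolding realizable_def by blast
qed

text \<open>
  Weighted adjacency matrices of a directed cycle labelled by \<open>w\<close>: a trace of a product counts the
  closed walks with the given labels, and a closed walk once around the cycle has weight \<open>c\<close>.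
\<close>

definition cycle_mat :: "'x list \<Rightarrow> 'f::comm_ring_1 \<Rightarrow> 'x \<Rightarrow> 'f mat" where
  "cycle_mat w c x = mat (length w) (length w)
     (\<lambda>(i, j). if w ! i = x \<and> j = Suc i mod length w then if i = 0 then c else 1 else 0)"

lemma cycle_mat_carrier: "cycle_mat w c x \<in> carrier_mat (length w) (length w)"
  by (simp add: cycle_mat_def)

text \<open>Each vertex \<open>i\<close> has a single outgoing edge, labelled \<open>w ! i\<close>,
  to its successor modulo \<open>length w\<close>. Hence at most one walk from \<open>i\<close>
  spells \<open>v\<close>, and it collects a factor \<open>c\<close> whenever it leaves vertex
  0.\<close>

lemma word_eval_cycle_mat:
  assumes "i < length w" "j < length w"
  shows "word_eval (length w) (cycle_mat w c) (Word v) $$ (i, j) =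
    (if j = (i + length v) mod length w \<and> (\<forall>k<length v. v ! k = w ! ((i + k) mod length w))
     then \<Prod>k<length v. if (i + k) mod length w = 0 then c else 1 else 0)"
  using assms(1)
proof (induction v arbitrary: i)
  case Nil
  then show ?case using assms(2) by (auto simp: word_eval_def)
next
  case (Cons x v)
  let ?l = "length w"
  let ?M = "word_eval ?l (cycle_mat w c) (Word v)"
  let ?s = "Suc i mod ?l"
  have M: "?M \<in> carrier_mat ?l ?l" by (rule word_eval_carrier) (rule cycle_mat_carrier)
  have s: "?s < ?l" using Cons.prems by (intro mod_less_divisor) linarith
  have "word_eval ?l (cycle_mat w c) (Word (x # v)) $$ (i, j) = (cycle_mat w c x * ?M) $$ (i, j)"
    by (simp add: word_eval_def)
  also have "\<dots> = (\<Sum>m<?l. cycle_mat w c x $$ (i, m) * ?M $$ (m, j))"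
    using Cons.prems assms(2) M cycle_mat_carrier[of w c x]
    by (auto simp: scalar_prod_def atLeast0LessThan intro!: sum.cong)
  \<comment> \<open>Row \<open>i\<close> of the adjacency matrix can be nonzero only at the
    successor \<open>?s\<close>.\<close>
  also have "\<dots> = (\<Sum>m<?l. if m = ?s then (if w ! i = x then (if i = 0 then c else 1) * ?M $$ (?s, j) else 0) else 0)"
    using Cons.prems by (intro sum.cong) (auto simp: cycle_mat_def)
  also have "\<dots> = (if w ! i = x then (if i = 0 then c else 1) * ?M $$ (?s, j) else 0)"
    using s by simp
  finally have step: "word_eval ?l (cycle_mat w c) (Word (x # v)) $$ (i, j) =
      (if w ! i = x then (if i = 0 then c else 1) * ?M $$ (?s, j) else 0)" .
  \<comment> \<open>The walk from \<open>?s\<close> is the tail of the walk from \<open>i\<close>,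
    so its positions are shifted by one.\<close>
  have shift: "(?s + k) mod ?l = (i + Suc k) mod ?l" for k
    by (simp add: mod_simps)
  have "(\<forall>k<length (x # v). (x # v) ! k = w ! ((i + k) mod ?l)) \<longleftrightarrow>
      w ! i = x \<and> (\<forall>k<length v. v ! k = w ! ((i + Suc k) mod ?l))"
    using Cons.prems by (auto simp: All_less_Suc2)
  moreover have "(\<Prod>k<length (x # v). if (i + k) mod ?l = 0 then c else 1) =
      (if i = 0 then c else 1) * (\<Prod>k<length v. if (i + Suc k) mod ?l = 0 then c else 1)"
    using Cons.prems by (simp add: prod.lessThan_Suc_shift del: prod.lessThan_Suc)
  ultimately show ?case
    unfolding step Cons.IH[OF s] shift by auto
qed

text \<open>Addition of \<open>i\<close> modulo \<open>l\<close> permutes the indices below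
  \<open>l\<close>. Thus a full turn of a cycle has the same weight wherever it starts.\<close>

lemma prod_mod_shift:
  fixes g :: "nat \<Rightarrow> 'a::comm_monoid_mult"
  assumes "i < l"
  shows "(\<Prod>k<l. g ((i + k) mod l)) = (\<Prod>k<l. g k)"
proof (rule prod.reindex_bij_witness[where i = "\<lambda>j. (j + (l - i)) mod l" and j = "\<lambda>k. (i + k) mod l"])
qed (use assms in \<open>auto simp: mod_if\<close>)

text \<open>A nonempty walk shorter than the cycle cannot close; one of full length from vertex
  \<open>i\<close> spells \<open>rotate i w\<close>. The sum runs over starting vertices, so a
  periodic \<open>w\<close> is counted with multiplicity.\<close>

lemma realizable_cycle:
  assumes "w \<noteq> []"
  shows "\<exists>\<tau>. realizable (length w) \<tau> \<and>
    (\<forall>v. v \<noteq> [] \<longrightarrow> length v < length w \<longrightarrow> \<tau> (Word v) = 0) \<and>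
    (\<forall>v. length v = length w \<longrightarrow> \<tau> (Word v) = (\<Sum>i<length w. if v = rotate i w then c else 0))"
proof -
  let ?l = "length w"
  define \<tau> where "\<tau> u = mat_trace (word_eval ?l (cycle_mat w c) u)" for u
  have "dim_row (word_eval ?l (cycle_mat w c) u) = ?l" for u
    using word_eval_carrier[of "cycle_mat w c" ?l u, OF cycle_mat_carrier] by simp
  then have \<tau>: "\<tau> u = (\<Sum>i<?l. word_eval ?l (cycle_mat w c) u $$ (i, i))" for u
    by (simp add: \<tau>_def mat_trace_def)
  have "realizable ?l \<tau>"
    unfolding realizable_def by (auto simp: \<tau>_def intro!: exI[of _ "cycle_mat w c"] cycle_mat_carrier)
  moreover have "\<tau> (Word v) = 0" if "v \<noteq> []" "length v < ?l" for v
  proof -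
    have "i \<noteq> (i + length v) mod ?l" if "i < ?l" for i
      using \<open>v \<noteq> []\<close> \<open>length v < ?l\<close> that by (cases "i + length v < ?l") (auto simp: mod_if)
    then show ?thesis by (simp add: \<tau> word_eval_cycle_mat)
  qed
  moreover have "\<tau> (Word v) = (\<Sum>i<?l. if v = rotate i w then c else 0)" if v: "length v = ?l" for v
    unfolding \<tau>
  proof (rule sum.cong)
    fix i assume "i \<in> {..<?l}"
    then have i: "i < ?l" by simp
    have "v = rotate i w \<longleftrightarrow> (\<forall>k<?l. v ! k = rotate i w ! k)"
      using v by (simp add: list_eq_iff_nth_eq)
    also have "\<dots> \<longleftrightarrow> (\<forall>k<?l. v ! k = w ! ((i + k) mod ?l))"
      using nth_rotate[of _ w i] by metis
    finally have rot: "v = rotate i w \<longleftrightarrow> (\<forall>k<?l. v ! k = w ! ((i + k) mod ?l))" .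
    \<comment> \<open>A full turn leaves vertex 0 exactly once and therefore has weight
      \<open>c\<close>.\<close>
    have "(\<Prod>k<?l. if (i + k) mod ?l = 0 then c else 1) = (\<Prod>k<?l. if k = 0 then c else 1)"
      by (rule prod_mod_shift[OF i])
    also have "\<dots> = c"
      using assms by (subst prod.delta) auto
    finally have weight: "(\<Prod>k<?l. if (i + k) mod ?l = 0 then c else 1) = c" .
    have "i = (i + ?l) mod ?l" using i by simp
    then show "word_eval ?l (cycle_mat w c) (Word v) $$ (i, i) = (if v = rotate i w then c else 0)"
      unfolding word_eval_cycle_mat[OF i i] rot v weight by meson
  qed simp
  ultimately show ?thesis by blast
qed

text \<open>Direct sum of the cycles for the words in \<open>W\<close>. The weights do not affect
  the size, which later makes the size uniform in the target function.\<close>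

lemma realizable_cycles:
  assumes "finite W" "0 < l" "\<forall>w\<in>W. length w = l"
  shows "\<exists>\<tau>. realizable (card W * l) \<tau> \<and>
    (\<forall>v. v \<noteq> [] \<longrightarrow> length v < l \<longrightarrow> \<tau> (Word v) = 0) \<and>
    (\<forall>v. length v = l \<longrightarrow> \<tau> (Word v) = (\<Sum>w\<in>W. \<Sum>i<l. if v = rotate i w then c w else 0))"
  using assms(1,3)
proof (induction W rule: finite_induct)
  case empty
  show ?case by (intro exI[of _ "\<lambda>w. 0"]) (simp add: realizable_null)
next
  case (insert w W)
  then obtain \<sigma> where \<sigma>: "realizable (card W * l) \<sigma>"
    "\<forall>v. v \<noteq> [] \<longrightarrow> length v < l \<longrightarrow> \<sigma> (Word v) = 0"
    "\<forall>v. length v = l \<longrightarrow> \<sigma> (Word v) = (\<Sum>w\<in>W. \<Sum>i<l. if v = rotate i w then c w else 0)"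
    by auto
  have w: "w \<noteq> []" "length w = l" using insert.prems assms(2) by auto
  from realizable_cycle[OF w(1), of "c w"] obtain \<tau> where \<tau>: "realizable l \<tau>"
    "\<forall>v. v \<noteq> [] \<longrightarrow> length v < l \<longrightarrow> \<tau> (Word v) = 0"
    "\<forall>v. length v = l \<longrightarrow> \<tau> (Word v) = (\<Sum>i<l. if v = rotate i w then c w else 0)"
    unfolding w(2) by blast
  show ?case
    using realizable_add[OF \<tau>(1) \<sigma>(1)] \<tau>(2,3) \<sigma>(2,3) insert.hyps
    by (intro exI[of _ "\<lambda>v. \<tau> v + \<sigma> v"]) simp
qed

section \<open>Rotation-invariant functions as traces\<close>

lemma cyclic_rotate:
  assumes "\<And>u v. t (u + v) = t (v + u)"
  shows "t (Word (rotate i w)) = t (Word w)"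
proof -
  have "t (Word (rotate1 v)) = t (Word v)" for v
    using assms[of "Word [hd v]" "Word (tl v)"] by (cases v) (auto simp: plus_nc_word_def)
  then show ?thesis by (induction i) auto
qed

text \<open>Rotation by \<open>l - i\<close> inverts rotation by \<open>i\<close> on words of length
  \<open>l\<close>, so for each starting vertex exactly one cycle spells a given word.\<close>

lemma card_rotate_preimage:
  assumes "length v = l" "i < l"
  shows "{w. length w = l \<and> v = rotate i w} = {rotate (l - i) v}"
proof -
  have "w = rotate (l - i) (rotate i w)" if "length w = l" for w :: "'a list"
    using that assms by (simp add: rotate_rotate rotate_id)
  moreover have "v = rotate i (rotate (l - i) v)"
    using assms by (simp add: rotate_rotate rotate_id)
  ultimately show ?thesis using assms by auto
qed

text \<open>
  Induction on \<open>d\<close>: cycles of length \<open>d + 1\<close> do not disturb the traces of shorter nonempty words.  The size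
  \<open>N\<close> must not depend on \<open>t\<close>, because it is also the trace of the empty word.
\<close>

lemma realizable_prescribed:
  "\<exists>N\<ge>1. \<forall>t :: 'x::finite nc_word \<Rightarrow> 'f::field_char_0. (\<forall>u v. t (u + v) = t (v + u)) \<longrightarrow>
     (\<exists>\<tau>. realizable N \<tau> \<and> (\<forall>w. w \<noteq> 0 \<longrightarrow> length (letters w) \<le> d \<longrightarrow> \<tau> w = t w))"
proof (induction d)
  case 0
  \<comment> \<open>Only the empty word has length 0, so nothing is prescribed and zero matrices of
    size 1 suffice.\<close>
  have "w = 0" if "letters w = []" for w :: "'x nc_word"
    using that by (cases w) (simp add: zero_nc_word_def)
  then show ?case
    using realizable_zero_matrices[of 1, where ?'f = 'f and ?'x = 'x] by (intro exI[of _ 1]) auto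
next
  case (Suc d)
  \<comment> \<open>One cycle for every word of this length avoids choosing representatives of
    rotation classes.\<close>
  let ?W = "{w :: 'x list. length w = Suc d}"
  have W: "finite ?W" using finite_lists_length_eq[of "UNIV :: 'x set" "Suc d"] by simp
  from Suc obtain N where N: "N \<ge> 1"
    "\<And>t :: 'x nc_word \<Rightarrow> 'f. (\<And>u v. t (u + v) = t (v + u)) \<Longrightarrow>
     \<exists>\<tau>. realizable N \<tau> \<and> (\<forall>w. w \<noteq> 0 \<longrightarrow> length (letters w) \<le> d \<longrightarrow> \<tau> w = t w)"
    by blast
  show ?case
  proof (intro exI[of _ "N + card ?W * Suc d"] conjI allI impI)
    show "N + card ?W * Suc d \<ge> 1" using N(1) by simp
    fix t :: "'x nc_word \<Rightarrow> 'f"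
    assume t: "\<forall>u v. t (u + v) = t (v + u)"
    then obtain \<sigma> where \<sigma>: "realizable N \<sigma>" "\<And>w. w \<noteq> 0 \<Longrightarrow> length (letters w) \<le> d \<Longrightarrow> \<sigma> w = t w"
      using N(2)[of t] by blast
    \<comment> \<open>The remaining defect is divided evenly among the \<open>Suc d\<close> starting
      vertices; the division uses characteristic 0.\<close>
    define c where "c w = (t (Word w) - \<sigma> (Word w)) / of_nat (Suc d)" for w
    have c: "c (rotate i w) = c w" for i w
      using cyclic_rotate[of t i w] cyclic_rotate[of \<sigma> i w] t realizable_cyclic[OF \<sigma>(1)]
      by (simp add: c_def)
    from realizable_cycles[OF W, of "Suc d" c] obtain \<tau> where \<tau>: "realizable (card ?W * Suc d) \<tau>"
      "\<And>v. v \<noteq> [] \<Longrightarrow> length v < Suc d \<Longrightarrow> \<tau> (Word v) = 0"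
      "\<And>v. length v = Suc d \<Longrightarrow> \<tau> (Word v) = (\<Sum>w\<in>?W. \<Sum>i<Suc d. if v = rotate i w then c w else 0)"
      by auto
    have top: "\<tau> (Word v) = t (Word v) - \<sigma> (Word v)" if v: "length v = Suc d" for v
    proof -
      \<comment> \<open>After the sums are exchanged, each \<open>i\<close> leaves exactly one word,
        a rotation of \<open>v\<close>, whose weight is \<open>c v\<close>.\<close>
      have "\<tau> (Word v) = (\<Sum>i<Suc d. \<Sum>w\<in>?W. if v = rotate i w then c w else 0)"
        unfolding \<tau>(3)[OF v] by (rule sum.swap)
      also have "\<dots> = (\<Sum>i<Suc d. c v)"
      proof (rule sum.cong)
        fix i assume "i \<in> {..<Suc d}"
        then have "{w \<in> ?W. v = rotate i w} = {rotate (Suc d - i) v}"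
          using card_rotate_preimage[OF v, of i] by simp
        then show "(\<Sum>w\<in>?W. if v = rotate i w then c w else 0) = c v"
          using W by (simp add: sum.If_cases Collect_conj_eq c del: lessThan_Suc)
      qed simp
      also have "\<dots> = t (Word v) - \<sigma> (Word v)"
        by (simp add: c_def del: of_nat_Suc sum.lessThan_Suc)
      finally show ?thesis .
    qed
    have "\<sigma> w + \<tau> w = t w" if "w \<noteq> 0" "length (letters w) \<le> Suc d" for w
    proof (cases "length (letters w) = Suc d")
      case True
      then show ?thesis using top[of "letters w"] by simp
    next
      \<comment> \<open>The new cycles contribute nothing to shorter nonempty words.\<close>
      case False
      then show ?thesis
        using that \<sigma>(2)[of w] \<tau>(2)[of "letters w"] by (cases w) (auto simp: zero_nc_word_def)
    qed
    with realizable_add[OF \<sigma>(1) \<tau>(1)]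
    show "\<exists>\<tau>. realizable (N + card ?W * Suc d) \<tau> \<and>
        (\<forall>w. w \<noteq> 0 \<longrightarrow> length (letters w) \<le> Suc d \<longrightarrow> \<tau> w = t w)"
      by blast
  qed
qed

section \<open>Comparison of functionals with traces\<close>

lemma linear_nc_poly_expand:
  fixes f :: "('x, 'f::field) nc_poly"
  assumes "Vector_Spaces.linear (\<lambda>c f. nc_const c * f) (*) \<phi>"
  shows "\<phi> f = (\<Sum>w\<in>Poly_Mapping.keys f. Poly_Mapping.lookup f w * \<phi> (Poly_Mapping.single w 1))"
proof -
  interpret Vector_Spaces.linear "\<lambda>c f :: ('x, 'f) nc_poly. nc_const c * f" "(*)" \<phi> by (rule assms)
  have "f = (\<Sum>w\<in>Poly_Mapping.keys f. nc_const (Poly_Mapping.lookup f w) * Poly_Mapping.single w 1)"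
    by (rule poly_mapping_eqI)
      (auto simp: nc_const_def mult_single lookup_sum lookup_single when_def in_keys_iff)
  then have "\<phi> f = \<phi> (\<Sum>w\<in>Poly_Mapping.keys f. nc_const (Poly_Mapping.lookup f w) * Poly_Mapping.single w 1)"
    by simp
  then show ?thesis by (simp add: sum scale)
qed

theorem theorem3p1:
  fixes r :: nat
    and fs :: "nat \<Rightarrow> ('x::finite, 'f::{alg_closed_field, field_char_0}) nc_poly"
    and f :: "('x, 'f) nc_poly"
  shows
    "(\<forall>n\<ge>1. \<forall>A :: 'x \<Rightarrow> 'f mat. (\<forall>x. A x \<in> carrier_mat n n) \<longrightarrow>
        (\<forall>i\<in>{1..r}. mat_trace (nc_eval n A (fs i)) = 0) \<longrightarrow> mat_trace (nc_eval n A f) = 0)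
     \<longleftrightarrow>
     (\<exists>c :: nat \<Rightarrow> 'f. cyc_equiv f (nc_lincomb r c fs)) \<or>
     (\<exists>(c :: nat \<Rightarrow> 'f) (a :: 'f). a \<noteq> 0 \<and> cyc_equiv (nc_lincomb r c fs) (nc_const a))"
    (is "?L \<longleftrightarrow> ?C \<or> ?D")
proof
  assume "?C \<or> ?D"
  show ?L
  proof (intro allI impI)
    fix n and A :: "'x \<Rightarrow> 'f mat"
    assume n: "1 \<le> n" and "\<forall>x. A x \<in> carrier_mat n n"
      and 0: "\<forall>i\<in>{1..r}. mat_trace (nc_eval n A (fs i)) = 0"
    then have A: "\<And>x. A x \<in> carrier_mat n n" by blast
    have lin: "mat_trace (nc_eval n A (nc_lincomb r c fs)) = 0" for c
      using 0 by (simp add: mat_trace_nc_eval_lincomb[OF A])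
    \<comment> \<open>In characteristic 0 a nonzero scalar has nonzero trace, so the second
      alternative is incompatible with the vanishing of all traces of the
      \<open>fs i\<close>.\<close>
    have "mat_trace (nc_eval n A (nc_const a)) = of_nat n * a" for a
      by (simp add: nc_eval_const mat_trace_def)
    then have "\<not> ?D"
      using mat_trace_nc_eval_cong[of A n, OF A] lin n by fastforce
    with \<open>?C \<or> ?D\<close> show "mat_trace (nc_eval n A f) = 0"
      using mat_trace_nc_eval_cong[of A n, OF A] lin by fastforce
  qed
next
  assume L: ?L
  show "?C \<or> ?D"
  proof (rule ccontr)
    assume neg: "\<not> (?C \<or> ?D)"
    let ?S = "{h. \<exists>c. cyc_equiv h (nc_lincomb r c fs)}"
    have "f \<notin> ?S" using neg by blast
    \<comment> \<open>Otherwise the second alternative would hold with the scalar 1.\<close>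
    moreover have "1 \<notin> ?S"
    proof
      assume "1 \<in> ?S"
      then obtain c where "cyc_equiv (nc_lincomb r c fs) (nc_const 1)"
        using cyc_equiv_sym by (auto simp: nc_const_1)
      then show False using neg zero_neq_one by metis
    qed
    ultimately obtain \<phi> where \<phi>: "Vector_Spaces.linear (\<lambda>c f. nc_const c * f) (*) \<phi>"
      "\<forall>s\<in>?S. \<phi> s = 0" "\<phi> f \<noteq> 0" "\<phi> 1 \<noteq> 0"
      using separating_functional2[OF vector_space_nc_poly subspace_cyc_lincomb] by blast
    interpret Vector_Spaces.linear "\<lambda>c f :: ('x, 'f) nc_poly. nc_const c * f" "(*)" \<phi> by (rule \<phi>(1))
    have fs0: "\<phi> (fs i) = 0" if "i \<in> {1..r}" for i
      using \<phi>(2) cyc_equiv_refl[of "fs i"] nc_lincomb_unit[OF that, of fs]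
      by (metis (mono_tags, lifting) mem_Collect_eq)
    have comm0: "\<phi> (p * q) = \<phi> (q * p)" for p q
    proof -
      have "p * q - q * p \<in> ?S"
        using cyc_equiv_commutator[of p q] nc_lincomb_0[of r fs] by (metis (mono_tags, lifting) mem_Collect_eq)
      then show ?thesis using \<phi>(2) diff[of "p * q" "q * p"] by simp
    qed
    define W where "W = Poly_Mapping.keys f \<union> (\<Union>i\<in>{1..r}. Poly_Mapping.keys (fs i))"
    \<comment> \<open>Inserting 0 keeps the argument of \<open>Max\<close> nonempty when all the
      polynomials are zero.\<close>
    define d where "d = Max (insert 0 ((\<lambda>w. length (letters w)) ` W))"
    have "finite W" by (simp add: W_def)
    then have d: "length (letters w) \<le> d" if "w \<in> W" for w
      using that by (simp add: d_def)
    obtain N where N: "N \<ge> 1"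
      "\<And>t :: 'x nc_word \<Rightarrow> 'f. (\<And>u v. t (u + v) = t (v + u)) \<Longrightarrow>
       \<exists>\<tau>. realizable N \<tau> \<and> (\<forall>w. w \<noteq> 0 \<longrightarrow> length (letters w) \<le> d \<longrightarrow> \<tau> w = t w)"
      using realizable_prescribed[of d, where ?'x = 'x and ?'f = 'f] by blast
    \<comment> \<open>\<open>N\<close> depends only on \<open>d\<close>, so the functional can be
      rescaled afterwards to give the empty word its forced trace \<open>N\<close>.\<close>
    define a where "a = of_nat N / \<phi> 1"
    have a: "a \<noteq> 0" using N(1) \<phi>(4) by (simp add: a_def)
    define t where "t w = a * \<phi> (Poly_Mapping.single w 1)" for w
    \<comment> \<open>The monomial of \<open>u + v\<close> is the product of those of
      \<open>u\<close> and \<open>v\<close>, so vanishing on commutators gives rotation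
      invariance.\<close>
    have "t (u + v) = t (v + u)" for u v
      using comm0[of "Poly_Mapping.single u 1" "Poly_Mapping.single v 1"] by (simp add: t_def mult_single)
    from N(2)[of t, OF this] obtain \<tau> where \<tau>: "realizable N \<tau>"
      "\<And>w. w \<noteq> 0 \<Longrightarrow> length (letters w) \<le> d \<Longrightarrow> \<tau> w = t w"
      by blast
    have "t 0 = of_nat N"
      using \<phi>(4) by (simp add: t_def a_def)
    then have \<tau>t: "\<tau> w = t w" if "w \<in> W" for w
      using \<tau>(2)[of w] d[OF that] realizable_empty_word[OF \<tau>(1)] by (cases "w = 0") auto
    obtain A where A: "\<And>x. A x \<in> carrier_mat N N" "\<And>w. mat_trace (word_eval N A w) = \<tau> w"
      using \<tau>(1) by (auto simp: realizable_def)
    have trace: "mat_trace (nc_eval N A h) = a * \<phi> h" if "Poly_Mapping.keys h \<subseteq> W" for h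
    proof -
      \<comment> \<open>Trace and functional expand into the same kind of weighted sum over words,
        so agreement up to the factor \<open>a\<close> on \<open>W\<close> is enough.\<close>
      have "mat_trace (nc_eval N A h) = (\<Sum>w\<in>Poly_Mapping.keys h. Poly_Mapping.lookup h w * t w)"
        unfolding mat_trace_nc_eval[of A N, OF A(1)] A(2)
        by (rule sum.cong) (use that \<tau>t in auto)
      also have "\<dots> = a * \<phi> h"
        unfolding linear_nc_poly_expand[OF \<phi>(1), of h] sum_distrib_left t_def
        by (rule sum.cong) (rule refl, rule mult.left_commute)
      finally show ?thesis .
    qed
    have "mat_trace (nc_eval N A (fs i)) = 0" if "i \<in> {1..r}" for i
    proof -
      have "Poly_Mapping.keys (fs i) \<subseteq> W" using that unfolding W_def by blast
      from trace[OF this] show ?thesis by (simp only: fs0[OF that] mult_zero_right)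
    qed
    \<comment> \<open>The premises hold at this tuple, yet the trace at \<open>f\<close> is the
      nonzero number \<open>a * \<phi> f\<close>.\<close>
    then have "mat_trace (nc_eval N A f) = 0"
      using L N(1) A(1) by blast
    moreover have "Poly_Mapping.keys f \<subseteq> W" unfolding W_def by blast
    ultimately have "a * \<phi> f = 0" using trace by metis
    then show False using a \<phi>(3) mult_eq_0_iff by blast
  qed
qed

end
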